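(* Let $(Y,\|\cdot\|)$ be a Banach space, let $\varphi:Y\to\mathbb{R}$ be a functional of class $C^2$, and let $0\in Y$ be a critical point of $\varphi$. Assume that there exist a splitting $Y=Y^+\oplus Y^-$ with $\dim Y^-<+\infty$, a norm $\|\cdot\|_w$ on $Y$ weaker than $\|\cdot\|$, and a constant $c>0$ such that $$\pm d^2\varphi(0)[z,z]\ge 2c\|z\|_w^2\qquad\forall z\in Y^\pm .$$ If there exists $\delta>0$ such that $$d^2\varphi(y)[y^+,y^+]\ge c\|y^+\|_w^2-c\|y^-\|_w^2\qquad\text{for all } y=y^++y^-\in Y^+\oplus Y^- \text{ with } \|y\|<\delta,$$ then $0$ is a non-degenerate critical point of $\varphi$, i.e. there exist a neighborhood $\mathcal U\subset Y$ of $0$ and a bounded linear hyperbolic operator $L:Y\to Y$ such that $\varphi$ is a Lyapounov function on $\mathcal U$ for the linear flow induced by $L$.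
   Context: "Splitting" means a topological direct sum of closed subspaces; for $y\in Y$, $y^\pm\in Y^\pm$ denote its components. "Weaker norm" means that $\|y\|_w\le C\|y\|$ for some constant $C$ and all $y\in Y$. A bounded linear operator $L:Y\to Y$ is hyperbolic if $\sigma(L)\cap i\mathbb{R}=\emptyset$. "$\varphi$ is a Lyapounov function on $\mathcal U$ for the linear flow induced by $L$" (at the critical point $0$) means $\frac{d}{dt}\big|_{t=0}\varphi(e^{tL}y)=d\varphi(y)[Ly]<0$ for all $y\in\mathcal U\setminus\{0\}$. *)

theory Defs
  imports "HOL-Analysis.Analysis"
begin

text \<open>Requiring addition to be a homeomorphism from the product onto the whole space contains
  existence, uniqueness and continuity of the components.\<close>

definition topological_direct_sum :: "'a::real_normed_vector set \<Rightarrow> 'a set \<Rightarrow> bool" where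
  "topological_direct_sum V W \<longleftrightarrow>
     subspace V \<and> closed V \<and> subspace W \<and> closed W \<and>
     (\<exists>g. homeomorphism (V \<times> W) UNIV (\<lambda>(v, w). v + w) g)"

definition finite_dimensional :: "'a::real_vector set \<Rightarrow> bool" where
  "finite_dimensional V \<longleftrightarrow> (\<exists>B. finite B \<and> span B = V)"

definition is_norm :: "('a::real_vector \<Rightarrow> real) \<Rightarrow> bool" where
  "is_norm w \<longleftrightarrow>
     (\<forall>x. w x \<ge> 0) \<and> (\<forall>x. w x = 0 \<longleftrightarrow> x = 0) \<and>
     (\<forall>r x. w (r *\<^sub>R x) = \<bar>r\<bar> * w x) \<and> (\<forall>x y. w (x + y) \<le> w x + w y)"

definition weaker_norm :: "('a::real_normed_vector \<Rightarrow> real) \<Rightarrow> bool" where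
  "weaker_norm w \<longleftrightarrow> is_norm w \<and> (\<exists>C. \<forall>y. w y \<le> C * norm y)"

text \<open>The spectrum of an operator on a real space is that of its complexification. The
  complexification of the space is the product of two copies of it, a pair \<open>(x, y)\<close> standing for
  \<open>x + i y\<close>. The inverse demanded below is only said to be real-linear; being the inverse of a
  complex-linear map it is automatically complex-linear.\<close>

definition complexified_scale :: "complex \<Rightarrow> 'a::real_vector \<times> 'a \<Rightarrow> 'a \<times> 'a" where
  "complexified_scale z p =
     (Re z *\<^sub>R fst p - Im z *\<^sub>R snd p, Im z *\<^sub>R fst p + Re z *\<^sub>R snd p)"

definition complexified_op ::
  "('a::real_normed_vector \<Rightarrow>\<^sub>L 'a) \<Rightarrow> 'a \<times> 'a \<Rightarrow> 'a \<times> 'a" where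
  "complexified_op L p = (blinfun_apply L (fst p), blinfun_apply L (snd p))"

definition op_spectrum :: "('a::real_normed_vector \<Rightarrow>\<^sub>L 'a) \<Rightarrow> complex set" where
  "op_spectrum L =
     {z. \<not> (\<exists>R. bounded_linear R \<and>
            (\<forall>p. R (complexified_scale z p - complexified_op L p) = p) \<and>
            (\<forall>p. complexified_scale z (R p) - complexified_op L (R p) = p))}"

definition hyperbolic_op :: "('a::real_normed_vector \<Rightarrow>\<^sub>L 'a) \<Rightarrow> bool" where
  "hyperbolic_op L \<longleftrightarrow> op_spectrum L \<inter> {z. Re z = 0} = {}"

text \<open>The type of bounded operators is not an instance of the algebra classes over which the
  library's \<open>exp\<close> is defined, so the exponential series is written out; it converges in operator
  norm on a Banach space.\<close>

definition op_exp :: "('a::banach \<Rightarrow>\<^sub>L 'a) \<Rightarrow> 'a \<Rightarrow>\<^sub>L 'a" where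
  "op_exp L = (\<Sum>n. (1 / fact n) *\<^sub>R ((\<lambda>M. L o\<^sub>L M) ^^ n) id_blinfun)"

definition lyapounov_function_on ::
  "'a::banach set \<Rightarrow> ('a \<Rightarrow> real) \<Rightarrow> ('a \<Rightarrow>\<^sub>L 'a) \<Rightarrow> bool" where
  "lyapounov_function_on U \<phi> L \<longleftrightarrow>
     (\<forall>y\<in>U - {0}.
        ((\<lambda>t. \<phi> (blinfun_apply (op_exp (t *\<^sub>R L)) y)) has_real_derivative
           frechet_derivative \<phi> (at y) (blinfun_apply L y)) (at 0) \<and>
        frechet_derivative \<phi> (at y) (blinfun_apply L y) < 0)"

definition nondegenerate_critical_point_0 :: "('a::banach \<Rightarrow> real) \<Rightarrow> bool" where
  "nondegenerate_critical_point_0 \<phi> \<longleftrightarrow>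
     (\<phi> has_derivative (\<lambda>_. 0)) (at 0) \<and>
     (\<exists>U L. 0 \<in> interior U \<and> hyperbolic_op L \<and> lyapounov_function_on U \<phi> L)"

end

theory Submission
  imports Defs
begin

text \<open>Let \<open>P\<close> and \<open>Q\<close> be the bounded projections onto \<open>Yp\<close> and \<open>Ym\<close> and put
  \<open>L = Q - P\<close>: the linear flow \<open>exp (- t) P + exp t Q\<close> contracts \<open>Yp\<close> and expands \<open>Ym\<close>, so it
  should decrease a functional that is roughly positive on \<open>Yp\<close> and negative on \<open>Ym\<close>.
  The spectrum of \<open>L\<close> lies in \<open>{-1, 1}\<close>, whence \<open>L\<close> is hyperbolic.

  For the Lyapounov property, \<open>D\<phi> 0 = 0\<close> and the mean value theorem along the segment from
  \<open>0\<close> to \<open>y\<close> give, for some \<open>0 < s < 1\<close>,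
  \[ D\<phi> y (L y) = D2\<phi> (s y) (P y + Q y) (Q y - P y)
      = D2\<phi> (s y) (Q y) (Q y) - D2\<phi> (s y) (P y) (P y). \]
  The mixed terms cancel because a continuous second derivative is symmetric, so the two
  summands can be estimated separately.

  The summand in \<open>P y\<close> is controlled by the assumption on a neighbourhood of \<open>0\<close>, applied at the
  point \<open>s y\<close> and divided by \<open>s\<^sup>2\<close>. Its defect \<open>c (w (Q y))\<^sup>2\<close> must be absorbed by the summand
  in \<open>Q y\<close>. At \<open>0\<close> this is at most \<open>- 2 c (w (Q y))\<^sup>2\<close>; and since \<open>Ym\<close> is finite-dimensional, \<open>w\<close>
  is equivalent there to the given norm, so norm continuity of \<open>D2\<phi>\<close> costs at most
  \<open>(c / 2) (w (Q y))\<^sup>2\<close> near \<open>0\<close>. What remains is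
  \<open>D\<phi> y (L y) \<le> - c (w (P y))\<^sup>2 - (c / 2) (w (Q y))\<^sup>2 < 0\<close> for \<open>y \<noteq> 0\<close>. If \<open>Yp\<close> is infinite-dimensional, the weak
  norm there need not absorb such a perturbation, which is why an estimate on \<open>Yp\<close> is assumed at all points
  near \<open>0\<close>.\<close>

section \<open>Symmetry of a continuous second derivative\<close>

text \<open>Two applications of the one-variable mean value theorem, first in the direction \<open>u\<close> and then
  in the direction \<open>v\<close>. The left-hand side of the identity is symmetric in \<open>u\<close> and \<open>v\<close>, which is
  what forces the symmetry of the second derivative.\<close>

lemma second_difference_mean_value:
  fixes \<phi> :: "'a::real_normed_vector \<Rightarrow> real"
    and D\<phi> :: "'a \<Rightarrow> 'a \<Rightarrow>\<^sub>L real"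
    and D2\<phi> :: "'a \<Rightarrow> 'a \<Rightarrow>\<^sub>L 'a \<Rightarrow>\<^sub>L real"
  assumes D1: "\<And>y. (\<phi> has_derivative blinfun_apply (D\<phi> y)) (at y)"
    and D2: "\<And>y. (D\<phi> has_derivative blinfun_apply (D2\<phi> y)) (at y)"
    and t: "t > 0"
  obtains \<xi> where "norm (\<xi> - x) \<le> t * (norm u + norm v)"
    and "\<phi> (x + t *\<^sub>R u + t *\<^sub>R v) - \<phi> (x + t *\<^sub>R u) - \<phi> (x + t *\<^sub>R v) + \<phi> x
           = t\<^sup>2 * D2\<phi> \<xi> v u"
proof -
  define g where "g = (\<lambda>s. \<phi> (x + s *\<^sub>R u + t *\<^sub>R v) - \<phi> (x + s *\<^sub>R u))"
  have dg: "(g has_real_derivative D\<phi> (x + s *\<^sub>R u + t *\<^sub>R v) u - D\<phi> (x + s *\<^sub>R u) u) (at s)" for s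
    unfolding g_def has_field_derivative_def
    by (auto intro!: derivative_eq_intros has_derivative_compose[OF _ D1]
        simp: blinfun.scaleR_right fun_eq_iff algebra_simps)
  obtain s where s: "0 < s" "s < t"
    "g t - g 0 = (t - 0) * (D\<phi> (x + s *\<^sub>R u + t *\<^sub>R v) u - D\<phi> (x + s *\<^sub>R u) u)"
    using MVT2[OF t dg] by blast
  define h where "h = (\<lambda>r. D\<phi> (x + s *\<^sub>R u + r *\<^sub>R v) u)"
  have dD: "((\<lambda>r. D\<phi> (x + s *\<^sub>R u + r *\<^sub>R v)) has_derivative
      (\<lambda>k. D2\<phi> (x + s *\<^sub>R u + r *\<^sub>R v) (k *\<^sub>R v))) (at r)" for r
    by (rule has_derivative_compose[OF _ D2]) (auto intro!: derivative_eq_intros)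
  have dh: "(h has_real_derivative D2\<phi> (x + s *\<^sub>R u + r *\<^sub>R v) v u) (at r)" for r
  proof -
    have "(h has_derivative (\<lambda>k. D2\<phi> (x + s *\<^sub>R u + r *\<^sub>R v) (k *\<^sub>R v) u)) (at r)"
      unfolding h_def by (rule bounded_linear.has_derivative[OF blinfun.bounded_linear_left dD])
    moreover have "(\<lambda>k. D2\<phi> (x + s *\<^sub>R u + r *\<^sub>R v) (k *\<^sub>R v) u) = (*) (D2\<phi> (x + s *\<^sub>R u + r *\<^sub>R v) v u)"
      by (simp add: fun_eq_iff blinfun.scaleR_right blinfun.scaleR_left)
    ultimately show ?thesis by (simp add: has_field_derivative_def)
  qed
  obtain r where r: "0 < r" "r < t" "h t - h 0 = (t - 0) * D2\<phi> (x + s *\<^sub>R u + r *\<^sub>R v) v u"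
    using MVT2[OF t dh] by blast
  show thesis
  proof
    have "norm (s *\<^sub>R u + r *\<^sub>R v) \<le> s * norm u + r * norm v"
      using s r by (metis abs_of_pos norm_scaleR norm_triangle_ineq)
    also have "\<dots> \<le> t * norm u + t * norm v"
      using s r by (intro add_mono mult_right_mono) auto
    finally show "norm (x + s *\<^sub>R u + r *\<^sub>R v - x) \<le> t * (norm u + norm v)"
      by (simp add: algebra_simps)
    show "\<phi> (x + t *\<^sub>R u + t *\<^sub>R v) - \<phi> (x + t *\<^sub>R u) - \<phi> (x + t *\<^sub>R v) + \<phi> x
           = t\<^sup>2 * D2\<phi> (x + s *\<^sub>R u + r *\<^sub>R v) v u"
      using s(3) r(3) by (simp add: g_def h_def power2_eq_square)
  qed
qed

text \<open>Writing the second difference with step \<open>t\<close> in both orders yields two points, tending to \<open>x\<close>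
  with \<open>t\<close>, at which the second derivatives in the two orders agree.\<close>

lemma continuous_second_derivative_symmetric:
  fixes \<phi> :: "'a::real_normed_vector \<Rightarrow> real"
    and D\<phi> :: "'a \<Rightarrow> 'a \<Rightarrow>\<^sub>L real"
    and D2\<phi> :: "'a \<Rightarrow> 'a \<Rightarrow>\<^sub>L 'a \<Rightarrow>\<^sub>L real"
  assumes D1: "\<And>y. (\<phi> has_derivative blinfun_apply (D\<phi> y)) (at y)"
    and D2: "\<And>y. (D\<phi> has_derivative blinfun_apply (D2\<phi> y)) (at y)"
    and cont: "continuous_on UNIV D2\<phi>"
  shows "D2\<phi> x u v = D2\<phi> x v u"
proof -
  define t :: "nat \<Rightarrow> real" where "t n = inverse (real (Suc n))" for n
  have t: "t n > 0" for n by (simp add: t_def)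
  have t0: "t \<longlonglongrightarrow> 0" unfolding t_def by (rule LIMSEQ_inverse_real_of_nat)
  have "\<exists>\<xi> \<eta>. norm (\<xi> - x) \<le> t n * (norm u + norm v) \<and> norm (\<eta> - x) \<le> t n * (norm u + norm v)
          \<and> D2\<phi> \<xi> v u = D2\<phi> \<eta> u v" for n
  proof -
    obtain \<xi> where \<xi>: "norm (\<xi> - x) \<le> t n * (norm u + norm v)"
      "\<phi> (x + t n *\<^sub>R u + t n *\<^sub>R v) - \<phi> (x + t n *\<^sub>R u) - \<phi> (x + t n *\<^sub>R v) + \<phi> x = (t n)\<^sup>2 * D2\<phi> \<xi> v u"
      using second_difference_mean_value[OF D1 D2 t] .
    obtain \<eta> where \<eta>: "norm (\<eta> - x) \<le> t n * (norm v + norm u)"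
      "\<phi> (x + t n *\<^sub>R v + t n *\<^sub>R u) - \<phi> (x + t n *\<^sub>R v) - \<phi> (x + t n *\<^sub>R u) + \<phi> x = (t n)\<^sup>2 * D2\<phi> \<eta> u v"
      using second_difference_mean_value[OF D1 D2 t] .
    have "(t n)\<^sup>2 * D2\<phi> \<xi> v u = (t n)\<^sup>2 * D2\<phi> \<eta> u v"
    proof -
      have swap: "x + t n *\<^sub>R v + t n *\<^sub>R u = x + t n *\<^sub>R u + t n *\<^sub>R v" by (simp add: algebra_simps)
      show ?thesis using \<xi>(2) \<eta>(2)[unfolded swap] by linarith
    qed
    with \<xi>(1) \<eta>(1) t[of n] show ?thesis by (auto simp: add.commute)
  qed
  then obtain \<xi> \<eta> where \<xi>: "\<And>n. norm (\<xi> n - x) \<le> t n * (norm u + norm v)"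
    and \<eta>: "\<And>n. norm (\<eta> n - x) \<le> t n * (norm u + norm v)"
    and eq: "\<And>n. D2\<phi> (\<xi> n) v u = D2\<phi> (\<eta> n) u v"
    by metis
  have lim: "(\<lambda>n. D2\<phi> (\<zeta> n) a b) \<longlonglongrightarrow> D2\<phi> x a b"
    if "\<And>n. norm (\<zeta> n - x) \<le> t n * (norm u + norm v)" for \<zeta> :: "nat \<Rightarrow> 'a" and a b
  proof -
    have "(\<lambda>n. t n * (norm u + norm v)) \<longlonglongrightarrow> 0"
      using t0 by (rule tendsto_mult_left_zero)
    then have "(\<lambda>n. \<zeta> n - x) \<longlonglongrightarrow> 0"
      by (rule Lim_null_comparison[rotated]) (use that in auto)
    then have "\<zeta> \<longlonglongrightarrow> x" by (rule LIM_zero_cancel)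
    then have "(\<lambda>n. D2\<phi> (\<zeta> n)) \<longlonglongrightarrow> D2\<phi> x"
      by (rule continuous_on_tendsto_compose[OF cont]) auto
    then show ?thesis by (intro tendsto_intros)
  qed
  show ?thesis
    using LIMSEQ_unique[OF lim[OF \<xi>, of v u]] lim[OF \<eta>, of u v] eq by simp
qed

section \<open>Projections of a topological direct sum\<close>

lemma continuous_linear_imp_bounded_linear:
  fixes f :: "'a::real_normed_vector \<Rightarrow> 'b::real_normed_vector"
  assumes "linear f" and "continuous (at 0) f"
  shows "bounded_linear f"
proof -
  interpret linear f by fact
  obtain d where d: "d > 0" "\<And>x. norm x < d \<Longrightarrow> norm (f x) < 1"
    using assms(2) zero unfolding continuous_at_eps_delta
    by (metis dist_norm diff_zero zero_less_one)
  show ?thesis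
  proof (rule bounded_linear_intro[OF add scale])
    fix x
    show "norm (f x) \<le> norm x * (2 / d)"
    proof (cases "x = 0")
      case False
      have "norm ((d / (2 * norm x)) *\<^sub>R x) < d" using d(1) False by simp
      from d(2)[OF this] have "d / (2 * norm x) * norm (f x) < 1"
        using d(1) by (simp add: scale)
      then show ?thesis using d(1) False by (simp add: field_simps)
    qed (simp add: zero)
  qed
qed

text \<open>Uniqueness of the components makes the inverse of \<open>(v, w) \<mapsto> v + w\<close> linear, and its continuity
  is the boundedness of the projections.\<close>

lemma topological_direct_sum_projections:
  fixes V W :: "'a::real_normed_vector set"
  assumes "topological_direct_sum V W"
  obtains P Q :: "'a \<Rightarrow>\<^sub>L 'a"
  where "\<And>y. P y \<in> V" "\<And>y. Q y \<in> W" "P + Q = id_blinfun"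
    "P o\<^sub>L P = P" "Q o\<^sub>L Q = Q" "P o\<^sub>L Q = 0" "Q o\<^sub>L P = 0"
proof -
  from assms obtain g where V: "subspace V" and W: "subspace W"
    and g: "homeomorphism (V \<times> W) UNIV (\<lambda>(v, w). v + w) g"
    unfolding topological_direct_sum_def by blast
  have gVW: "fst (g y) \<in> V" "snd (g y) \<in> W" and gsum: "fst (g y) + snd (g y) = y" for y
  proof -
    have "g y \<in> V \<times> W" using g unfolding homeomorphism_def by blast
    then show "fst (g y) \<in> V" "snd (g y) \<in> W" by auto
    have "(\<lambda>(v, w). v + w) (g y) = y" using g unfolding homeomorphism_def by blast
    then show "fst (g y) + snd (g y) = y" by (simp add: case_prod_beta)
  qed
  have guniq: "g (v + w) = (v, w)" if "v \<in> V" "w \<in> W" for v w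
    using g that unfolding homeomorphism_def by force
  have "linear g"
  proof (rule linearI)
    fix x y :: 'a and r :: real
    have "g ((fst (g x) + fst (g y)) + (snd (g x) + snd (g y))) = g x + g y"
      by (subst guniq) (auto intro: subspace_add V W gVW simp: plus_prod_def)
    moreover have "(fst (g x) + fst (g y)) + (snd (g x) + snd (g y)) = x + y"
      using gsum[of x] gsum[of y] by (metis add.assoc add.left_commute)
    ultimately show "g (x + y) = g x + g y" by simp
    have "g (r *\<^sub>R fst (g x) + r *\<^sub>R snd (g x)) = r *\<^sub>R g x"
      by (subst guniq) (auto intro: subspace_scale V W gVW simp: scaleR_prod_def)
    then show "g (r *\<^sub>R x) = r *\<^sub>R g x"
      by (simp add: gsum flip: scaleR_add_right)
  qed
  moreover have "continuous (at 0) g"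
    using g unfolding homeomorphism_def by (simp add: continuous_on_eq_continuous_at)
  ultimately have bg: "bounded_linear g" by (rule continuous_linear_imp_bounded_linear)
  define P where "P = Blinfun (\<lambda>y. fst (g y))"
  define Q where "Q = Blinfun (\<lambda>y. snd (g y))"
  have P: "P y = fst (g y)" for y
    unfolding P_def by (simp add: bounded_linear_Blinfun_apply bounded_linear_fst_comp bg)
  have Q: "Q y = snd (g y)" for y
    unfolding Q_def by (simp add: bounded_linear_Blinfun_apply bounded_linear_snd_comp bg)
  have gV: "g v = (v, 0)" if "v \<in> V" for v
    using guniq[OF that subspace_0[OF W]] by simp
  have gW: "g w = (0, w)" if "w \<in> W" for w
    using guniq[OF subspace_0[OF V] that] by simp
  show thesis
    by (rule that[of P Q])
       (auto intro!: blinfun_eqI simp: P Q gVW gsum gV gW blinfun.add_left)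
qed

section \<open>Norms on a finite-dimensional subspace\<close>

text \<open>The box is an iterated sum of compact segments. This is the only source of compactness in the
  comparison of norms below.\<close>

lemma compact_coefficient_box:
  fixes B :: "'a::real_normed_vector set"
  assumes "finite B"
  shows "compact {\<Sum>b\<in>B. a b *\<^sub>R b | a. \<forall>b\<in>B. \<bar>a b\<bar> \<le> (1::real)}"
  using assms
proof (induction B rule: finite_induct)
  case empty
  then show ?case by simp
next
  case (insert x B)
  let ?K = "\<lambda>B. {\<Sum>b\<in>B. a b *\<^sub>R b | a. \<forall>b\<in>B. \<bar>a b\<bar> \<le> (1::real)}"
  have "?K (insert x B) = (\<lambda>(t, k). t *\<^sub>R x + k) ` ({-1..1} \<times> ?K B)" (is "?l = ?r")
  proof
    show "?l \<subseteq> ?r"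
    proof
      fix y assume "y \<in> ?l"
      then obtain a where a: "\<forall>b\<in>insert x B. \<bar>a b\<bar> \<le> 1" "y = (\<Sum>b\<in>insert x B. a b *\<^sub>R b)"
        by blast
      then have "y = a x *\<^sub>R x + (\<Sum>b\<in>B. a b *\<^sub>R b)" using insert by simp
      moreover have "a x \<in> {-1..1}" using a by (auto simp: abs_le_iff)
      moreover have "(\<Sum>b\<in>B. a b *\<^sub>R b) \<in> ?K B" using a by blast
      ultimately show "y \<in> ?r" by (intro image_eqI[of _ _ "(a x, \<Sum>b\<in>B. a b *\<^sub>R b)"]) auto
    qed
    show "?r \<subseteq> ?l"
    proof
      fix y assume "y \<in> ?r"
      then obtain t a where a: "t \<in> {-1..1}" "\<forall>b\<in>B. \<bar>a b\<bar> \<le> 1"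
        "y = t *\<^sub>R x + (\<Sum>b\<in>B. a b *\<^sub>R b)"
        by auto
      have "(\<Sum>b\<in>B. (a(x := t)) b *\<^sub>R b) = (\<Sum>b\<in>B. a b *\<^sub>R b)"
        using insert by (intro sum.cong) auto
      then have "y = (\<Sum>b\<in>insert x B. (a(x := t)) b *\<^sub>R b)"
        using insert a by simp
      moreover have "\<forall>b\<in>insert x B. \<bar>(a(x := t)) b\<bar> \<le> 1"
        using a by (auto simp: abs_le_iff)
      ultimately show "y \<in> ?l" by blast
    qed
  qed
  moreover have "compact \<dots>"
    using insert by (intro compact_continuous_image compact_Times)
      (auto intro!: continuous_intros simp: case_prod_beta)
  ultimately show ?case by simp
qed

lemma weaker_norm_continuous:
  assumes "weaker_norm w"
  shows "continuous_on UNIV w"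
proof -
  from assms obtain C where n: "is_norm w" and C: "\<And>y. w y \<le> C * norm y"
    unfolding weaker_norm_def by blast
  have sub: "w x - w y \<le> C * norm (x - y)" for x y
  proof -
    have "w ((x - y) + y) \<le> w (x - y) + w y" using n unfolding is_norm_def by blast
    then show ?thesis using C[of "x - y"] by simp
  qed
  have "norm (w x - w y) \<le> \<bar>C\<bar> * norm (x - y)" for x y
  proof -
    have "C * norm (x - y) \<le> \<bar>C\<bar> * norm (x - y)" by (intro mult_right_mono) auto
    then show ?thesis using sub[of x y] sub[of y x] by (simp add: norm_minus_commute abs_le_iff)
  qed
  then have "\<bar>C\<bar>-lipschitz_on UNIV w"
    by (intro lipschitz_onI) (auto simp: dist_norm)
  then show ?thesis by (rule lipschitz_on_continuous_on)
qed

text \<open>Every nonzero vector of \<open>V\<close> is a multiple of one whose coefficients in a fixed basis are bounded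
  by \<open>1\<close> with one of them equal to \<open>1\<close>. These vectors form a compact set \<open>T\<close> which avoids \<open>0\<close> by
  linear independence, so the continuous quotient of the two norms is bounded on \<open>T\<close>, and by homogeneity on
  all of \<open>V\<close>.\<close>

lemma weaker_norm_equivalent_on_finite_dimensional:
  fixes V :: "'a::real_normed_vector set"
  assumes V: "finite_dimensional V" and w: "weaker_norm w"
  obtains K where "K > 0" "\<And>z. z \<in> V \<Longrightarrow> norm z \<le> K * w z"
proof -
  have wn: "is_norm w" using w unfolding weaker_norm_def by blast
  obtain B where fin: "finite B" and ind: "independent B" and span: "span B = V"
  proof -
    obtain B0 where "finite B0" "span B0 = V" using V unfolding finite_dimensional_def by blast
    moreover obtain B where "B \<subseteq> B0" "independent B" "B0 \<subseteq> span B"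
      using maximal_independent_subset .
    ultimately show thesis
      by (intro that[of B]) (auto intro: finite_subset simp: span_eq dest: span_mono span_minimal[OF _ subspace_span])
  qed
  let ?K = "\<lambda>B. {\<Sum>b\<in>B. a b *\<^sub>R b | a. \<forall>b\<in>B. \<bar>a b\<bar> \<le> (1::real)}"
  define T where "T = (\<Union>b\<in>B. (+) b ` ?K (B - {b}))"
  have "compact T" unfolding T_def
    by (intro compact_UN fin compact_continuous_image continuous_intros compact_coefficient_box) (simp add: fin)
  have nz: "z \<noteq> 0" if "z \<in> T" for z
  proof
    assume "z = 0"
    from that obtain b where b: "b \<in> B" and "z \<in> (+) b ` ?K (B - {b})"
      unfolding T_def by (rule UN_E)
    then obtain k where "z = b + k" and "k \<in> ?K (B - {b})" by (elim imageE)
    moreover from this(2) obtain a where "k = (\<Sum>b\<in>B - {b}. a b *\<^sub>R b)" by blast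
    ultimately have z: "b + (\<Sum>b\<in>B - {b}. a b *\<^sub>R b) = 0" using \<open>z = 0\<close> by simp
    have "(\<Sum>b'\<in>B - {b}. (a(b := 1)) b' *\<^sub>R b') = (\<Sum>b'\<in>B - {b}. a b' *\<^sub>R b')"
      by (intro sum.cong) auto
    then have "(\<Sum>b'\<in>B. (a(b := 1)) b' *\<^sub>R b') = 0"
      using z sum.remove[OF fin b, of "\<lambda>b'. (a(b := 1)) b' *\<^sub>R b'"] by simp
    from independentD[OF ind fin subset_refl this b] show False by simp
  qed
  have rep: "\<exists>r t. t \<in> T \<and> z = r *\<^sub>R t" if "z \<in> V" "z \<noteq> 0" for z
  proof -
    obtain a where a: "z = (\<Sum>b\<in>B. a b *\<^sub>R b)"
      using \<open>z \<in> V\<close> span_finite[OF fin] span by auto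
    have "B \<noteq> {}" using a \<open>z \<noteq> 0\<close> by auto
    define r where "r = Max ((\<lambda>b. \<bar>a b\<bar>) ` B)"
    have "r \<in> (\<lambda>b. \<bar>a b\<bar>) ` B" unfolding r_def using fin \<open>B \<noteq> {}\<close> by (intro Max_in) auto
    then obtain b where b: "b \<in> B" "r = \<bar>a b\<bar>" by blast
    have le: "\<bar>a b'\<bar> \<le> \<bar>a b\<bar>" if "b' \<in> B" for b'
      unfolding b(2)[symmetric] r_def using fin that by (intro Max_ge) auto
    have ab: "a b \<noteq> 0"
    proof
      assume "a b = 0"
      then have "a b' = 0" if "b' \<in> B" for b' using le[OF that] by simp
      then show False using a \<open>z \<noteq> 0\<close> by simp
    qed
    \<comment> \<open>Dividing by a coefficient of largest modulus, with its sign, lands in \<open>T\<close>.\<close>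
    let ?t = "b + (\<Sum>b'\<in>B - {b}. (a b' / a b) *\<^sub>R b')"
    have "(\<Sum>b'\<in>B - {b}. (a b' / a b) *\<^sub>R b') \<in> ?K (B - {b})"
      using le ab by (intro CollectI exI[of _ "\<lambda>b'. a b' / a b"] conjI refl) auto
    then have "?t \<in> T" unfolding T_def using b(1) by blast
    moreover have "z = a b *\<^sub>R ?t"
      using a sum.remove[OF fin b(1), of "\<lambda>b'. a b' *\<^sub>R b'"] ab
      by (simp add: scaleR_add_right scaleR_sum_right)
    ultimately show ?thesis by blast
  qed
  show thesis
  proof (cases "T = {}")
    case True
    then have "z = 0" if "z \<in> V" for z using rep[OF that] by auto
    then have "norm z \<le> 1 * w z" if "z \<in> V" for z using that wn by (metis is_norm_def mult_1 norm_zero)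
    then show thesis by (rule that[OF zero_less_one])
  next
    case False
    have wpos: "w t > 0" if "t \<in> T" for t
      using nz[OF that] wn unfolding is_norm_def by (metis less_le)
    have "continuous_on T (\<lambda>t. norm t / w t)"
      using wpos continuous_on_subset[OF weaker_norm_continuous[OF w]]
      by (intro continuous_intros) force+
    from continuous_attains_sup[OF \<open>compact T\<close> False this]
    obtain t0 where t0: "t0 \<in> T" "\<And>t. t \<in> T \<Longrightarrow> norm t / w t \<le> norm t0 / w t0" by blast
    show thesis
    proof (rule that[of "norm t0 / w t0"])
      show "norm t0 / w t0 > 0" using nz[OF t0(1)] wpos[OF t0(1)] by simp
      fix z assume "z \<in> V"
      show "norm z \<le> norm t0 / w t0 * w z"
      proof (cases "z = 0")
        case True
        then show ?thesis using wn by (simp add: is_norm_def)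
      next
        case False
        then obtain r t where t: "t \<in> T" and z: "z = r *\<^sub>R t" using rep \<open>z \<in> V\<close> by blast
        have "norm t \<le> norm t0 / w t0 * w t"
          using t0(2)[OF t] wpos[OF t] by (simp add: pos_divide_le_eq)
        then have "\<bar>r\<bar> * norm t \<le> \<bar>r\<bar> * (norm t0 / w t0 * w t)" by (rule mult_left_mono) simp
        then show ?thesis using wn by (simp add: z is_norm_def mult.left_commute)
      qed
    qed
  qed
qed

section \<open>The flow and the spectrum of a difference of complementary projections\<close>

text \<open>The powers of \<open>t (Q - P)\<close> are \<open>(- t)\<^sup>n P + t\<^sup>n Q\<close>, so the exponential series splits into two
  scalar ones.\<close>

lemma op_exp_diff_projections:
  fixes P Q :: "'a::banach \<Rightarrow>\<^sub>L 'a"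
  assumes PQ: "P + Q = id_blinfun" "P o\<^sub>L P = P" "Q o\<^sub>L Q = Q" "P o\<^sub>L Q = 0" "Q o\<^sub>L P = 0"
  shows "op_exp (t *\<^sub>R (Q - P)) = exp (- t) *\<^sub>R P + exp t *\<^sub>R Q"
proof -
  let ?M = "t *\<^sub>R (Q - P)"
  have app: "P (P y) = P y" "Q (Q y) = Q y" "P (Q y) = 0" "Q (P y) = 0" for y
    using PQ by (metis blinfun_apply_blinfun_compose zero_blinfun.rep_eq)+
  have pow: "((\<lambda>M. ?M o\<^sub>L M) ^^ n) id_blinfun = (- t) ^ n *\<^sub>R P + t ^ n *\<^sub>R Q" for n
  proof (induction n)
    case 0
    then show ?case using PQ(1) by simp
  next
    case (Suc n)
    show ?case
      unfolding funpow.simps comp_apply Suc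
      by (rule blinfun_eqI)
        (simp add: blinfun.bilinear_simps app algebra_simps)
  qed
  have "(\<lambda>n. ((- t) ^ n /\<^sub>R fact n) *\<^sub>R P + (t ^ n /\<^sub>R fact n) *\<^sub>R Q)
      sums (exp (- t) *\<^sub>R P + exp t *\<^sub>R Q)"
    by (intro sums_add bounded_linear.sums[OF bounded_linear_scaleR_left] exp_converges)
  then have "(\<lambda>n. (1 / fact n) *\<^sub>R ((\<lambda>M. ?M o\<^sub>L M) ^^ n) id_blinfun)
      sums (exp (- t) *\<^sub>R P + exp t *\<^sub>R Q)"
    by (simp only: pow scaleR_add_right scaleR_scaleR divide_inverse real_scaleR_def mult_1)
  then show ?thesis unfolding op_exp_def by (rule sums_unique[symmetric])
qed

lemma complexified_scale_mult:
  "complexified_scale a (complexified_scale b p) = complexified_scale (a * b) p"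
  by (simp add: complexified_scale_def algebra_simps)

lemma complexified_scale_1: "complexified_scale 1 p = p"
  by (simp add: complexified_scale_def)

lemma complexified_op_scale:
  "complexified_op L (complexified_scale a p) = complexified_scale a (complexified_op L p)"
  by (simp add: complexified_scale_def complexified_op_def blinfun.bilinear_simps)

lemma bounded_linear_complexified_scale_op:
  fixes P :: "'a::real_normed_vector \<Rightarrow>\<^sub>L 'a"
  shows "bounded_linear (\<lambda>p. complexified_scale a (complexified_op P p))"
proof -
  have 1: "bounded_linear (\<lambda>p :: 'a \<times> 'a. P (fst p))" "bounded_linear (\<lambda>p :: 'a \<times> 'a. P (snd p))"
    by (intro bounded_linear_compose[OF blinfun.bounded_linear_right] bounded_linear_fst bounded_linear_snd)+
  show ?thesis
    unfolding complexified_scale_def complexified_op_def fst_conv snd_conv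
    by (intro bounded_linear_Pair bounded_linear_add bounded_linear_sub
        bounded_linear_compose[OF bounded_linear_scaleR_right] 1)
qed

text \<open>As \<open>z - (Q - P)\<close> acts as multiplication by \<open>z + 1\<close> on the range of \<open>P\<close> and by \<open>z - 1\<close> on
  that of \<open>Q\<close>, it can be inverted explicitly unless \<open>z = 1\<close> or \<open>z = - 1\<close>.\<close>

lemma hyperbolic_diff_projections:
  fixes P Q :: "'a::real_normed_vector \<Rightarrow>\<^sub>L 'a"
  assumes PQ: "P + Q = id_blinfun" "P o\<^sub>L P = P" "Q o\<^sub>L Q = Q" "P o\<^sub>L Q = 0" "Q o\<^sub>L P = 0"
  shows "hyperbolic_op (Q - P)"
proof -
  let ?s = complexified_scale and ?P = "complexified_op P" and ?Q = "complexified_op Q"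
  have "z \<notin> op_spectrum (Q - P)" if z: "Re z = 0" for z
  proof -
    have nz: "z + 1 \<noteq> 0" "z - 1 \<noteq> 0" using z by (auto simp: complex_eq_iff)
    define R where "R p = ?s (inverse (z + 1)) (?P p) + ?s (inverse (z - 1)) (?Q p)" for p
    have split: "?P p + ?Q p = p" for p
    proof -
      have "P y + Q y = y" for y using PQ(1) by (metis blinfun.add_left id_blinfun.rep_eq id_apply)
      then show ?thesis by (simp add: complexified_op_def)
    qed
    have app: "P (P y) = P y" "Q (Q y) = Q y" "P (Q y) = 0" "Q (P y) = 0" for y
      using PQ by (metis blinfun_apply_blinfun_compose zero_blinfun.rep_eq)+
    have capp: "?P (?P p) = ?P p" "?Q (?Q p) = ?Q p" "?P (?Q p) = 0" "?Q (?P p) = 0" for p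
      by (auto simp: complexified_op_def app zero_prod_def)
    have add: "complexified_op T (p + q) = complexified_op T p + complexified_op T q"
      for T :: "'a \<Rightarrow>\<^sub>L 'a" and p q by (simp add: complexified_op_def blinfun.add_right)
    have s0: "?s a (0 :: 'a \<times> 'a) = 0" for a by (simp add: complexified_scale_def zero_prod_def)
    have zL: "?s z p - complexified_op (Q - P) p = ?s (z + 1) (?P p) + ?s (z - 1) (?Q p)" for p
    proof -
      have "?s z p - complexified_op (Q - P) p = ?s z (?P p + ?Q p) - complexified_op (Q - P) p"
        by (simp add: split)
      also have "\<dots> = ?s (z + 1) (?P p) + ?s (z - 1) (?Q p)"
        by (simp add: complexified_scale_def complexified_op_def blinfun.bilinear_simps algebra_simps)
      finally show ?thesis .
    qed
    have "bounded_linear R"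
      unfolding R_def by (intro bounded_linear_add bounded_linear_complexified_scale_op)
    moreover have "R (?s z p - complexified_op (Q - P) p) = p" for p
      unfolding zL R_def using nz split[of p]
      by (simp add: add complexified_op_scale capp s0 complexified_scale_mult complexified_scale_1)
    moreover have "?s z (R p) - complexified_op (Q - P) (R p) = p" for p
      unfolding zL R_def using nz split[of p]
      by (simp add: add complexified_op_scale capp s0 complexified_scale_mult complexified_scale_1)
    ultimately show ?thesis unfolding op_spectrum_def by blast
  qed
  then show ?thesis unfolding hyperbolic_op_def by blast
qed

section \<open>The Lyapounov property\<close>

theorem theorem3p7:
  fixes \<phi> :: "'a::banach \<Rightarrow> real"
    and D\<phi> :: "'a \<Rightarrow> 'a \<Rightarrow>\<^sub>L real"
    and D2\<phi> :: "'a \<Rightarrow> 'a \<Rightarrow>\<^sub>L 'a \<Rightarrow>\<^sub>L real"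
    and Yp Ym :: "'a set"
    and w :: "'a \<Rightarrow> real"
    and c :: real
  assumes "\<And>y. (\<phi> has_derivative blinfun_apply (D\<phi> y)) (at y)"
    and "\<And>y. (D\<phi> has_derivative blinfun_apply (D2\<phi> y)) (at y)"
    and "continuous_on UNIV D2\<phi>"
    and "D\<phi> 0 = 0"
    and "topological_direct_sum Yp Ym"
    and "finite_dimensional Ym"
    and "weaker_norm w"
    and "c > 0"
    and "\<And>z. z \<in> Yp \<Longrightarrow> blinfun_apply (blinfun_apply (D2\<phi> 0) z) z \<ge> 2 * c * (w z)\<^sup>2"
    and "\<And>z. z \<in> Ym \<Longrightarrow> - blinfun_apply (blinfun_apply (D2\<phi> 0) z) z \<ge> 2 * c * (w z)\<^sup>2"
    and "\<exists>\<delta>>0. \<forall>yp\<in>Yp. \<forall>ym\<in>Ym. norm (yp + ym) < \<delta> \<longrightarrow>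
           blinfun_apply (blinfun_apply (D2\<phi> (yp + ym)) yp) yp \<ge> c * (w yp)\<^sup>2 - c * (w ym)\<^sup>2"
  shows "nondegenerate_critical_point_0 \<phi>"
proof -
  note D1 = assms(1) and D2 = assms(2) and cont = assms(3)
  have wn: "is_norm w" using assms(7) unfolding weaker_norm_def by blast
  obtain P Q :: "'a \<Rightarrow>\<^sub>L 'a" where PQ: "\<And>y. P y \<in> Yp" "\<And>y. Q y \<in> Ym" "P + Q = id_blinfun"
    "P o\<^sub>L P = P" "Q o\<^sub>L Q = Q" "P o\<^sub>L Q = 0" "Q o\<^sub>L P = 0"
    using topological_direct_sum_projections[OF assms(5)] by metis
  have split: "P y + Q y = y" for y
    using PQ(3) by (metis blinfun.add_left id_blinfun.rep_eq id_apply)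
  obtain K where K: "K > 0" "\<And>z. z \<in> Ym \<Longrightarrow> norm z \<le> K * w z"
    using weaker_norm_equivalent_on_finite_dimensional[OF assms(6,7)] by blast
  obtain \<delta> where \<delta>: "\<delta> > 0" "\<And>yp ym. yp \<in> Yp \<Longrightarrow> ym \<in> Ym \<Longrightarrow> norm (yp + ym) < \<delta> \<Longrightarrow>
      D2\<phi> (yp + ym) yp yp \<ge> c * (w yp)\<^sup>2 - c * (w ym)\<^sup>2"
    using assms(11) by blast
  \<comment> \<open>Since \<open>norm z \<le> K * w z\<close> on \<open>Ym\<close>, a perturbation of the Hessian by \<open>\<epsilon>\<close> changes it on \<open>z\<close> by
    at most \<open>\<epsilon> * K\<^sup>2 * (w z)\<^sup>2 = c / 2 * (w z)\<^sup>2\<close>, half of the margin between \<open>2 * c\<close> and \<open>c\<close>.\<close>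
  define \<epsilon> where "\<epsilon> = c / (2 * K\<^sup>2)"
  have "\<epsilon> > 0" using assms(8) K by (simp add: \<epsilon>_def)
  then obtain \<eta> where \<eta>: "\<eta> > 0" "\<And>y. norm y < \<eta> \<Longrightarrow> norm (D2\<phi> y - D2\<phi> 0) < \<epsilon>"
    using cont unfolding continuous_on_iff by (metis UNIV_I dist_norm diff_zero)
  have plus: "D2\<phi> y (P y) (P y) \<ge> c * (w (P y))\<^sup>2 - c * (w (Q y))\<^sup>2" if "norm y < \<delta>" for y
    using \<delta>(2)[OF PQ(1) PQ(2), of y y] that by (simp add: split)
  have minus: "D2\<phi> y z z \<le> - (3/2) * c * (w z)\<^sup>2" if "norm y < \<eta>" "z \<in> Ym" for y z
  proof -
    have "(D2\<phi> y - D2\<phi> 0) z z \<le> norm ((D2\<phi> y - D2\<phi> 0) z z)" by simp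
    also have "\<dots> \<le> norm ((D2\<phi> y - D2\<phi> 0) z) * norm z" by (rule norm_blinfun)
    also have "\<dots> \<le> norm (D2\<phi> y - D2\<phi> 0) * norm z * norm z"
      by (intro mult_right_mono norm_blinfun) auto
    also have "\<dots> = norm (D2\<phi> y - D2\<phi> 0) * (norm z)\<^sup>2" by (simp add: power2_eq_square)
    also have "\<dots> \<le> \<epsilon> * (K * w z)\<^sup>2"
      using \<eta>(2)[OF that(1)] K(2)[OF that(2)] \<open>\<epsilon> > 0\<close> by (intro mult_mono power_mono) auto
    also have "\<dots> = c / 2 * (w z)\<^sup>2"
      using K(1) by (simp add: \<epsilon>_def power_mult_distrib field_simps)
    finally show ?thesis using assms(10)[OF that(2)] by (simp add: blinfun.diff_left)
  qed
  have neg: "D\<phi> y (Q y - P y) < 0" if y: "norm y < min \<delta> \<eta>" "y \<noteq> 0" for y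
  proof -
    let ?v = "Q y - P y"
    have "((\<lambda>s. D\<phi> (s *\<^sub>R y)) has_derivative (\<lambda>k. D2\<phi> (s *\<^sub>R y) (k *\<^sub>R y))) (at s)" for s
      by (rule has_derivative_compose[OF _ D2]) (auto intro!: derivative_eq_intros)
    then have "((\<lambda>s. D\<phi> (s *\<^sub>R y) ?v) has_derivative (\<lambda>k. D2\<phi> (s *\<^sub>R y) (k *\<^sub>R y) ?v)) (at s)" for s
      by (rule bounded_linear.has_derivative[OF blinfun.bounded_linear_left])
    then have "((\<lambda>s. D\<phi> (s *\<^sub>R y) ?v) has_real_derivative D2\<phi> (s *\<^sub>R y) y ?v) (at s)" for s
      unfolding has_field_derivative_def
      by (simp add: blinfun.scaleR_right blinfun.scaleR_left mult.commute[of _ "blinfun_apply _ _"])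
    from MVT2[OF zero_less_one this] obtain s where s: "0 < s" "s < 1"
      "D\<phi> y ?v = D2\<phi> (s *\<^sub>R y) y ?v"
      using assms(4) by auto
    have ns: "norm (s *\<^sub>R y) < min \<delta> \<eta>"
    proof -
      have "norm (s *\<^sub>R y) \<le> norm y" using s by (simp add: mult_left_le_one_le)
      then show ?thesis using y by linarith
    qed
    let ?D = "D2\<phi> (s *\<^sub>R y)"
    have "?D y ?v = ?D (P y + Q y) ?v" by (simp add: split)
    also have "\<dots> = ?D (Q y) (Q y) - ?D (P y) (P y)"
      using continuous_second_derivative_symmetric[OF D1 D2 cont, of "s *\<^sub>R y" "P y" "Q y"]
      by (simp add: blinfun.bilinear_simps)
    finally have eq: "D\<phi> y ?v = ?D (Q y) (Q y) - ?D (P y) (P y)" using s by simp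
    \<comment> \<open>The estimate at \<open>s *\<^sub>R y\<close> concerns the components \<open>s *\<^sub>R P y\<close> and \<open>s *\<^sub>R Q y\<close>; it can be
      divided by \<open>s\<^sup>2\<close> because the mean value theorem gives \<open>s > 0\<close>.\<close>
    have "s\<^sup>2 * ?D (P y) (P y) \<ge> s\<^sup>2 * (c * (w (P y))\<^sup>2 - c * (w (Q y))\<^sup>2)"
      using plus[of "s *\<^sub>R y"] ns wn s
      by (simp add: blinfun.bilinear_simps is_norm_def power_mult_distrib power2_eq_square algebra_simps)
    then have a: "?D (P y) (P y) \<ge> c * (w (P y))\<^sup>2 - c * (w (Q y))\<^sup>2" using s by simp
    have b: "?D (Q y) (Q y) \<le> - (3/2) * c * (w (Q y))\<^sup>2" using minus ns PQ(2) by simp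
    have "P y \<noteq> 0 \<or> Q y \<noteq> 0" using split[of y] y(2) by auto
    then have "w (P y) \<noteq> 0 \<or> w (Q y) \<noteq> 0" using wn unfolding is_norm_def by blast
    then have "(w (P y))\<^sup>2 + (w (Q y))\<^sup>2 / 2 > 0"
      by (auto intro: add_pos_nonneg add_nonneg_pos)
    then have "c * ((w (P y))\<^sup>2 + (w (Q y))\<^sup>2 / 2) > 0" using assms(8) by simp
    then show ?thesis using a b eq by (simp add: algebra_simps)
  qed
  have "lyapounov_function_on (ball 0 (min \<delta> \<eta>)) \<phi> (Q - P)"
    unfolding lyapounov_function_on_def
  proof (intro ballI conjI)
    fix y :: 'a assume y: "y \<in> ball 0 (min \<delta> \<eta>) - {0}"
    have fd: "frechet_derivative \<phi> (at y) = D\<phi> y" using frechet_derivative_at[OF D1] by metis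
    show "frechet_derivative \<phi> (at y) ((Q - P) y) < 0"
      using neg[of y] y by (simp add: fd blinfun.diff_left)
    have "((\<lambda>t. exp (- t) *\<^sub>R P y + exp t *\<^sub>R Q y) has_derivative (\<lambda>k. k *\<^sub>R (Q y - P y))) (at 0)"
      by (auto intro!: derivative_eq_intros simp: algebra_simps)
    moreover have "(\<phi> has_derivative D\<phi> y) (at (exp (- 0) *\<^sub>R P y + exp 0 *\<^sub>R Q y))"
      using D1[of y] by (simp add: split)
    ultimately have "((\<lambda>t. \<phi> (exp (- t) *\<^sub>R P y + exp t *\<^sub>R Q y)) has_derivative
        (\<lambda>k. D\<phi> y (k *\<^sub>R (Q y - P y)))) (at 0)"
      by (rule has_derivative_compose)
    moreover have "(\<lambda>k. D\<phi> y (k *\<^sub>R (Q y - P y))) = (*) (D\<phi> y ((Q - P) y))"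
      by (simp add: fun_eq_iff blinfun.scaleR_right blinfun.diff_left)
    ultimately show "((\<lambda>t. \<phi> (op_exp (t *\<^sub>R (Q - P)) y)) has_real_derivative
        frechet_derivative \<phi> (at y) ((Q - P) y)) (at 0)"
      by (simp add: op_exp_diff_projections[OF PQ(3-7)] fd has_field_derivative_def
          blinfun.add_left blinfun.scaleR_left)
  qed
  moreover have "0 \<in> interior (ball 0 (min \<delta> \<eta>) :: 'a set)" using \<delta> \<eta> by simp
  moreover have "(\<phi> has_derivative (\<lambda>_. 0)) (at 0)"
    using D1[of 0] assms(4) by (simp add: zero_blinfun.rep_eq)
  ultimately show ?thesis
    unfolding nondegenerate_critical_point_0_def
    using hyperbolic_diff_projections[OF PQ(3-7)] by blast
qed

end
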